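(* Consider the pencil of quartic surfaces $f_0+\lambda q^2=0$, $\lambda\in\mathbb{P}_1$, in $\mathbb{P}_3=\mathbb{P}_3(\mathbb{C})$, where $q=x_0^2+x_1^2+x_2^2+x_3^2$ and $f_0=x_0^4+x_1^4+x_2^4+x_3^4$ ($\lambda=\infty$ being the double quadric $q^2=0$). The singular surfaces of the pencil with $\lambda\neq\infty$ are exactly those with $\lambda=-1,-\frac12,-\frac13,-\frac14$. Their singularities are all ordinary double points (nodes), namely: for $\lambda=-1$ the $4$ points obtained from $(1:0:0:0)$ by permuting coordinates; for $\lambda=-\frac12$ the $12$ points obtained from $(\pm1:\pm1:0:0)$ by permuting coordinates; for $\lambda=-\frac13$ the $16$ points obtained from $(\pm1:\pm1:\pm1:0)$ by permuting coordinates; for $\lambda=-\frac14$ the $8$ points $(\pm1:\pm1:\pm1:\pm1)$. *)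

theory Defs
  imports "HOL-Analysis.Analysis"
begin

text \<open>A point of complex projective space is encoded as the set of its homogeneous
  coordinate vectors.\<close>

definition proj_point :: "complex ^ 'n \<Rightarrow> (complex ^ 'n) set" where
  "proj_point x = {c *s x | c. c \<noteq> 0}"

text \<open>Polynomials are represented by their polynomial functions, and \<open>partial_deriv\<close> is the
  complex partial derivative, which for these agrees with the formal one.\<close>

definition partial_deriv :: "'n \<Rightarrow> (complex ^ 'n \<Rightarrow> complex) \<Rightarrow> complex ^ 'n \<Rightarrow> complex" where
  "partial_deriv i F x = deriv (\<lambda>t. F (x + t *s axis i 1)) 0"

definition hessian :: "(complex ^ 'n \<Rightarrow> complex) \<Rightarrow> complex ^ 'n \<Rightarrow> complex ^ 'n ^ 'n" where
  "hessian g y = (\<chi> j k. partial_deriv j (partial_deriv k g) y)"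

text \<open>Jacobian criterion for the projective hypersurface \<open>F = 0\<close>, with \<open>F\<close> homogeneous; for
  such \<open>F\<close> the condition does not depend on the representative \<open>x\<close>.\<close>

definition sing_points :: "(complex ^ 'n \<Rightarrow> complex) \<Rightarrow> (complex ^ 'n) set set" where
  "sing_points F =
     {proj_point x | x. x \<noteq> 0 \<and> F x = 0 \<and> (\<forall>i. partial_deriv i F x = 0)}"

definition singular_surface :: "(complex ^ 4 \<Rightarrow> complex) \<Rightarrow> bool" where
  "singular_surface F \<longleftrightarrow> sing_points F \<noteq> {}"

text \<open>The index type \<open>4\<close> is arithmetic modulo 4, so the homogeneous coordinates
  are \<open>x $ 0, \<dots>, x $ 3\<close>. The chart \<open>x\<^sub>i = 1\<close> numbers its three affine coordinates
  cyclically, as those with index \<open>i + 1\<close>, \<open>i + 2\<close>, \<open>i + 3\<close>.\<close>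

definition affine_chart :: "4 \<Rightarrow> complex ^ 3 \<Rightarrow> complex ^ 4" where
  "affine_chart i y =
     (\<chi> j. if j = i then 1
           else if j = i + 1 then y $ 0
           else if j = i + 2 then y $ 1
           else y $ 2)"

text \<open>Ordinary double point of the affine surface \<open>g = 0\<close>: the Taylor expansion of \<open>g\<close> starts
  with a nondegenerate quadratic form.\<close>

definition affine_node :: "(complex ^ 3 \<Rightarrow> complex) \<Rightarrow> complex ^ 3 \<Rightarrow> bool" where
  "affine_node g y \<longleftrightarrow>
     g y = 0 \<and> (\<forall>j. partial_deriv j g y = 0) \<and> det (hessian g y) \<noteq> 0"

definition ordinary_double_point :: "(complex ^ 4 \<Rightarrow> complex) \<Rightarrow> (complex ^ 4) set \<Rightarrow> bool" where
  "ordinary_double_point F P \<longleftrightarrow>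
     (\<exists>i y. P = proj_point (affine_chart i y) \<and> affine_node (\<lambda>z. F (affine_chart i z)) y)"

definition q :: "complex ^ 4 \<Rightarrow> complex" where
  "q x = (x $ 0)^2 + (x $ 1)^2 + (x $ 2)^2 + (x $ 3)^2"

definition f0 :: "complex ^ 4 \<Rightarrow> complex" where
  "f0 x = (x $ 0)^4 + (x $ 1)^4 + (x $ 2)^4 + (x $ 3)^4"

datatype P1 = Finite complex | Infinity

fun pencil :: "P1 \<Rightarrow> complex ^ 4 \<Rightarrow> complex" where
  "pencil (Finite l) = (\<lambda>x. f0 x + l * (q x)^2)"
| "pencil Infinity = (\<lambda>x. (q x)^2)"

definition coords :: "complex \<Rightarrow> complex \<Rightarrow> complex \<Rightarrow> complex \<Rightarrow> complex ^ 4" where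
  "coords a b c d = (\<chi> i. if i = 0 then a else if i = 1 then b else if i = 2 then c else d)"

definition perm_points :: "(complex ^ 4) set \<Rightarrow> (complex ^ 4) set set" where
  "perm_points V = {proj_point (\<chi> i. v $ \<pi> i) | v \<pi>. v \<in> V \<and> bij \<pi>}"

abbreviation pm1 :: "complex set" where
  "pm1 \<equiv> {1, -1}"

end

theory Submission
  imports Defs
begin

text \<open>For \<open>F = f\<^sub>0 + \<lambda> q\<^sup>2\<close> one has \<open>\<partial>F/\<partial>x\<^sub>i = 4 x\<^sub>i (x\<^sub>i\<^sup>2 + \<lambda> q)\<close>, so at a singular
  point all nonzero coordinates have the same square \<open>-\<lambda> q\<close>, and after scaling they
  are \<open>\<plusminus>1\<close>. If \<open>k\<close> coordinates are nonzero, then \<open>q = k\<close> and the equations reduce to \<open>\<lambda> k = -1\<close>.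
  In an affine chart at such a point the Hessian is \<open>-4\<close> times the identity on the vanishing
  coordinates and \<open>8 (I + \<lambda> v v\<^sup>T)\<close>, with \<open>v\<close> a sign vector of length \<open>k - 1\<close>, on the others; its
  determinant is \<open>\<plusminus>4\<^sup>4\<^sup>-\<^sup>k 8\<^sup>k\<^sup>-\<^sup>1 / k \<noteq> 0\<close>.\<close>

text \<open>With \<open>c = 0\<close> this is the pencil; with \<open>c = 1\<close> it is the pencil in any affine chart.\<close>

definition pencil_poly :: "complex \<Rightarrow> complex \<Rightarrow> complex ^ 'n \<Rightarrow> complex" where
  "pencil_poly c l x = c + (\<Sum>i\<in>UNIV. (x $ i)^4) + l * (c + (\<Sum>i\<in>UNIV. (x $ i)^2))^2"

section \<open>Derivatives of the pencil\<close>

lemma partial_deriv_eqI: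
  assumes "((\<lambda>t. F (x + t *s axis i 1)) has_field_derivative D) (at 0)"
  shows "partial_deriv i F x = D"
  using assms unfolding partial_deriv_def by (rule DERIV_imp_deriv)

lemma has_field_derivative_coord_line:
  "((\<lambda>t. (x + t *s axis i 1) $ j) has_field_derivative (if j = i then 1 else 0)) (at t)"
proof -
  have "(\<lambda>t. (x + t *s axis i 1) $ j) = (\<lambda>t. x $ j + t * (if j = i then 1 else 0))"
    by (auto simp: axis_def)
  then show ?thesis
    by (auto intro!: derivative_eq_intros)
qed

lemma partial_deriv_pencil_poly:
  "partial_deriv i (pencil_poly c l) x =
     4 * x $ i * ((x $ i)^2 + l * (c + (\<Sum>j\<in>UNIV. (x $ j)^2)))"
proof (rule partial_deriv_eqI)
  show "((\<lambda>t. pencil_poly c l (x + t *s axis i 1)) has_field_derivative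
      4 * x $ i * ((x $ i)^2 + l * (c + (\<Sum>j\<in>UNIV. (x $ j)^2)))) (at 0)"
    unfolding pencil_poly_def
    by (rule derivative_eq_intros has_field_derivative_coord_line refl)+
      (simp add: mult_delta_left mult_delta_right algebra_simps power2_eq_square power3_eq_cube)
qed

text \<open>The form is chosen as a rank-one matrix plus a diagonal one, so that
  \<open>det_diagonal_plus_rank_one_3\<close> applies to it.\<close>

lemma hessian_pencil_poly:
  "hessian (pencil_poly c l) x $ j $ k =
     8 * l * x $ j * x $ k +
     (if j = k then 12 * (x $ k)^2 + 4 * l * (c + (\<Sum>i\<in>UNIV. (x $ i)^2)) else 0)"
proof -
  have eq: "partial_deriv k (pencil_poly c l) =
      (\<lambda>x. 4 * x $ k * ((x $ k)^2 + l * (c + (\<Sum>j\<in>UNIV. (x $ j)^2))))"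
    by (rule ext) (rule partial_deriv_pencil_poly)
  have "partial_deriv j (partial_deriv k (pencil_poly c l)) x =
     8 * l * x $ j * x $ k +
     (if j = k then 12 * (x $ k)^2 + 4 * l * (c + (\<Sum>i\<in>UNIV. (x $ i)^2)) else 0)"
    unfolding eq
    by (rule partial_deriv_eqI,
        (rule derivative_eq_intros has_field_derivative_coord_line refl)+)
      (auto simp: mult_delta_left mult_delta_right algebra_simps power2_eq_square)
  then show ?thesis
    by (simp add: hessian_def)
qed

section \<open>Sums over coordinates and affine charts\<close>

lemma sum_UNIV_4: "(\<Sum>i\<in>(UNIV :: 4 set). f i) = f 0 + f 1 + f 2 + f 3"
proof -
  \<comment> \<open>\<open>sum_4\<close> runs over the indices 1 to 4, and in the type
    \<open>4\<close> the last of these is 0.\<close>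
  have four: "(4 :: 4) = 0" by simp
  show ?thesis unfolding sum_4 four by (simp add: ac_simps)
qed

lemma sum_UNIV_3: "(\<Sum>i\<in>(UNIV :: 3 set). f i) = f 0 + f 1 + f 2"
proof -
  have three: "(3 :: 3) = 0" by simp
  show ?thesis unfolding sum_3 three by (simp add: ac_simps)
qed

lemma pencil_Finite: "pencil (Finite l) = pencil_poly 0 l"
  by (auto simp: pencil_poly_def f0_def q_def sum_UNIV_4)

text \<open>Besides the entry 1, a chart only rearranges the affine coordinates. The summand
  \<open>f\<close> stays arbitrary to cover both squares and fourth powers.\<close>

lemma sum_affine_chart:
  fixes f :: "complex \<Rightarrow> complex"
  shows "(\<Sum>j\<in>UNIV. f (affine_chart i y $ j)) = f 1 + (\<Sum>j\<in>UNIV. f (y $ j))"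
proof -
  have four: "(4 :: 4) = 0" by simp
  show ?thesis
    using exhaust_4[of i] unfolding four
    by (elim disjE) (simp_all add: sum_UNIV_4 sum_UNIV_3 affine_chart_def)
qed

text \<open>By symmetry of the pencil the chart index \<open>i\<close> disappears, so one node
  computation serves all four charts.\<close>

lemma pencil_affine_chart: "(\<lambda>y. pencil (Finite l) (affine_chart i y)) = pencil_poly 1 l"
  unfolding pencil_Finite pencil_poly_def
  by (simp add: sum_affine_chart[where f = "\<lambda>z. z ^ 4"] sum_affine_chart[where f = "\<lambda>z. z ^ 2"])

section \<open>Sign vectors as normal forms of singular points\<close>

definition signed_vecs :: "nat \<Rightarrow> (complex ^ 'n) set" where
  "signed_vecs k = {x. (\<forall>i. x $ i \<in> {0, 1, -1}) \<and> card {i. x $ i \<noteq> 0} = k}"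

lemma signed_vecs_nonzero:
  assumes "x \<in> signed_vecs k" "k \<noteq> 0"
  obtains i where "x $ i \<noteq> 0"
proof (rule ccontr)
  assume "\<not> thesis"
  then have "{i. x $ i \<noteq> 0} = {}"
    using that by blast
  with assms show False
    by (simp add: signed_vecs_def)
qed

text \<open>Used with \<open>s = - l * Q\<close> at an arbitrary singular point and with
  \<open>s = 1\<close> at sign vectors.\<close>

lemma sum_squares_const:
  fixes x :: "complex ^ 'n"
  assumes "\<And>i. x $ i \<noteq> 0 \<Longrightarrow> (x $ i)^2 = s"
  shows "(\<Sum>i\<in>UNIV. (x $ i)^2) = of_nat (card {i. x $ i \<noteq> 0}) * s"
proof -
  have "(\<Sum>i\<in>UNIV. (x $ i)^2) = (\<Sum>i\<in>{i. x $ i \<noteq> 0}. (x $ i)^2)"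
    by (rule sum.mono_neutral_right) auto
  also have "\<dots> = (\<Sum>i\<in>{i. x $ i \<noteq> 0}. s)"
    by (rule sum.cong) (auto simp: assms)
  finally show ?thesis by simp
qed

lemma sum_squares_signed_vecs:
  assumes "x \<in> signed_vecs k"
  shows "(\<Sum>i\<in>UNIV. (x $ i)^2) = of_nat k"
  using sum_squares_const[of x 1] assms by (force simp: signed_vecs_def)

lemma proj_point_scale:
  assumes "c \<noteq> 0"
  shows "proj_point (c *s x) = proj_point x"
proof -
  have "\<exists>e. d *s x = e *s (c *s x) \<and> e \<noteq> 0" if "d \<noteq> 0" for d
    using that assms by (intro exI[of _ "d / c"]) (simp add: vector_smult_assoc)
  moreover have "\<exists>e. d *s (c *s x) = e *s x \<and> e \<noteq> 0" if "d \<noteq> 0" for d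
    using that assms by (intro exI[of _ "d * c"]) (simp add: vector_smult_assoc)
  ultimately show ?thesis
    unfolding proj_point_def by auto
qed

lemma proj_point_eqD:
  assumes "proj_point x = proj_point y"
  shows "\<exists>c. c \<noteq> 0 \<and> y = c *s x"
proof -
  have "y \<in> proj_point y"
    unfolding proj_point_def by (auto intro!: exI[of _ 1])
  with assms show ?thesis
    unfolding proj_point_def by auto
qed

text \<open>The number \<open>k\<close> of nonzero coordinates may stay existential:
  \<open>l * of_nat k = -1\<close> determines it and excludes 0.\<close>

lemma sing_points_pencil_poly:
  fixes l :: complex
  shows "sing_points (pencil_poly 0 l :: complex ^ 'n \<Rightarrow> complex) =
           proj_point ` {x. \<exists>k. x \<in> signed_vecs k \<and> l * of_nat k = -1}"
    (is "?S = proj_point ` ?T")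
proof (intro equalityI subsetI)
  fix P assume "P \<in> ?S"
  then obtain x where P: "P = proj_point x" and "x \<noteq> 0"
    and deriv0: "\<And>i. partial_deriv i (pencil_poly 0 l) x = 0"
    unfolding sing_points_def by auto
  define Q where "Q = (\<Sum>j\<in>UNIV. (x $ j)^2)"
  define k where "k = card {i. x $ i \<noteq> 0}"
  have sq: "(x $ i)^2 = - l * Q" if "x $ i \<noteq> 0" for i
    using deriv0[of i] that by (simp add: partial_deriv_pencil_poly Q_def eq_neg_iff_add_eq_0)
  \<comment> \<open>Summing \<open>sq\<close> over the nonzero coordinates leaves an equation in
    \<open>Q\<close> alone, from which \<open>Q\<close> can be cancelled.\<close>
  have Qk: "Q = of_nat k * (- l * Q)"
    unfolding k_def by (subst Q_def) (rule sum_squares_const, rule sq)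
  obtain i0 where i0: "x $ i0 \<noteq> 0"
    using \<open>x \<noteq> 0\<close> by (auto simp: vec_eq_iff)
  with sq[of i0] have "Q \<noteq> 0" by auto
  with Qk have lk: "l * of_nat k = -1"
    by (simp add: field_simps) (metis minus_minus mult.commute mult_cancel_left1 mult_minus_right)
  \<comment> \<open>Dividing by one nonzero coordinate makes the common square equal to 1, with no
    choice of a square root.\<close>
  define y where "y = inverse (x $ i0) *s x"
  have "y $ i = 0 \<or> (y $ i)^2 = 1" for i
    using sq[of i] sq[of i0] i0 by (cases "x $ i = 0") (auto simp: y_def field_simps)
  moreover have "{i. y $ i \<noteq> 0} = {i. x $ i \<noteq> 0}"
    using i0 by (auto simp: y_def)
  ultimately have "y \<in> signed_vecs k"
    by (auto simp: signed_vecs_def k_def power2_eq_1_iff)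
  moreover have "P = proj_point y"
    using i0 by (simp add: P y_def proj_point_scale)
  ultimately show "P \<in> proj_point ` ?T"
    using lk by blast
next
  fix P assume "P \<in> proj_point ` ?T"
  then obtain x k where P: "P = proj_point x" and x: "x \<in> signed_vecs k"
    and lk: "l * of_nat k = -1"
    by auto
  have s2: "(\<Sum>i\<in>UNIV. (x $ i)^2) = of_nat k"
    using x by (rule sum_squares_signed_vecs)
  have "(x $ i)^4 = (x $ i)^2" for i
  proof -
    have "x $ i \<in> {0, 1, -1}"
      using x by (simp add: signed_vecs_def)
    then show ?thesis by auto
  qed
  then have s4: "(\<Sum>i\<in>UNIV. (x $ i)^4) = of_nat k"
    using s2 by simp
  \<comment> \<open>The bracketing isolates \<open>l * of_nat k\<close>, so that the value becomes
    \<open>k - k\<close>.\<close>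
  have "pencil_poly 0 l x = of_nat k + (l * of_nat k) * of_nat k"
    unfolding pencil_poly_def s2 s4 by (simp add: power2_eq_square)
  then have "pencil_poly 0 l x = 0"
    by (simp add: lk)
  moreover have "partial_deriv i (pencil_poly 0 l) x = 0" for i
    using x by (auto simp: partial_deriv_pencil_poly s2 lk signed_vecs_def)
  moreover have "x \<noteq> 0"
    using x lk by (auto simp: signed_vecs_def)
  ultimately show "P \<in> ?S"
    unfolding sing_points_def P by blast
qed

lemma sing_points_pencil:
  assumes "k \<noteq> 0"
  shows "sing_points (pencil (Finite (- (1 / of_nat k)))) = proj_point ` signed_vecs k"
proof -
  have "{x. \<exists>m. x \<in> signed_vecs m \<and> - (1 / of_nat k) * of_nat m = (-1 :: complex)} =
      (signed_vecs k :: (complex ^ 4) set)"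
    using assms by (auto simp: field_simps)
  then show ?thesis
    unfolding pencil_Finite sing_points_pencil_poly by simp
qed

section \<open>Nodes in affine charts\<close>

text \<open>Matrix determinant lemma in adjugate form, free of division. Higher powers of
  \<open>m\<close> cancel because all larger minors of the rank-one part vanish.\<close>

lemma det_diagonal_plus_rank_one_3:
  fixes M :: "'a::comm_ring_1 ^ 3 ^ 3"
  assumes "\<And>i j. M $ i $ j = m * (v $ i * v $ j) + (if i = j then d i else 0)"
  shows "det M = d 0 * d 1 * d 2 +
    m * ((v $ 0)^2 * d 1 * d 2 + (v $ 1)^2 * d 0 * d 2 + (v $ 2)^2 * d 0 * d 1)"
proof -
  have three: "(3 :: 3) = 0" by simp
  show ?thesis
    unfolding det_3 assms three by (simp add: algebra_simps power2_eq_square)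
qed

text \<open>The summand 1 in \<open>lk\<close> is the square of the chart coordinate, so
  \<open>lk\<close> is the relation \<lambda> k = -1 read in the chart.\<close>

lemma affine_node_pencil_poly:
  fixes y :: "complex ^ 3"
  assumes y: "\<And>j. y $ j \<in> {0, 1, -1}"
    and lk: "l * (1 + (\<Sum>j\<in>UNIV. (y $ j)^2)) = -1"
  shows "affine_node (pencil_poly 1 l) y"
proof -
  let ?Q = "1 + (\<Sum>j\<in>UNIV. (y $ j)^2)"
  have "(y $ i)^4 = (y $ i)^2" for i
    using y[of i] by auto
  then have "pencil_poly 1 l y = ?Q + (l * ?Q) * ?Q"
    by (simp add: pencil_poly_def power2_eq_square)
  then have zero: "pencil_poly 1 l y = 0"
    by (simp add: lk)
  have crit: "partial_deriv j (pencil_poly 1 l) y = 0" for j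
    using y[of j] by (auto simp: partial_deriv_pencil_poly lk)
  have "det (hessian (pencil_poly 1 l) y) \<noteq> 0"
  proof -
    define a b c where "a = (y $ 0)^2" and "b = (y $ 1)^2" and "c = (y $ 2)^2"
    \<comment> \<open>Since \<open>l * ?Q = -1\<close>, the diagonal part of the Hessian is 8 where
      the coordinate is \<plusminus>1 and -4 where it vanishes.\<close>
    let ?d = "\<lambda>s. 12 * s - 4 :: complex"
    have "hessian (pencil_poly 1 l) y $ j $ k =
        8 * l * (y $ j * y $ k) + (if j = k then ?d ((y $ j)^2) else 0)" for j k
      by (simp add: hessian_pencil_poly lk)
    then have det: "det (hessian (pencil_poly 1 l) y) =
        ?d a * ?d b * ?d c + 8 * l * (a * ?d b * ?d c + b * ?d a * ?d c + c * ?d a * ?d b)"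
      unfolding a_def b_def c_def by (rule det_diagonal_plus_rank_one_3)
    have abc: "a \<in> {0, 1}" "b \<in> {0, 1}" "c \<in> {0, 1}"
      using y[of 0] y[of 1] y[of 2] by (auto simp: a_def b_def c_def)
    have "l * (1 + a + b + c) = -1"
      using lk by (simp add: sum_UNIV_3 a_def b_def c_def add.assoc)
    then have l: "l = - 1 / (1 + a + b + c)"
      by (metis eq_divide_imp mult_zero_right zero_neq_neg_one)
    \<comment> \<open>Eight numerical cases remain. With \<open>k = 1 + a + b + c\<close> the
      rank-one term multiplies the diagonal product by
      \<open>1 + l * (k - 1) = 1 / k\<close>.\<close>
    show ?thesis
      using abc unfolding det unfolding l by auto
  qed
  with zero crit show ?thesis
    by (simp add: affine_node_def)
qed

lemma affine_chart_surj:
  assumes "x $ i = 1"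
  obtains y where "x = affine_chart i y"
proof -
  define y :: "complex ^ 3" where
    "y = (\<chi> j. if j = 0 then x $ (i + 1) else if j = 1 then x $ (i + 2) else x $ (i + 3))"
  \<comment> \<open>The case split takes \<open>i\<close> from 1 to 4, so the cyclic indices
    \<open>i + 1\<close>, \<open>i + 2\<close>, \<open>i + 3\<close> reach 7 before reduction modulo
    4.\<close>
  have wrap: "(4 :: 4) = 0" "(5 :: 4) = 1" "(6 :: 4) = 2" "(7 :: 4) = 3"
    by simp_all
  have "x = affine_chart i y"
    using exhaust_4[of i] assms
    by (elim disjE) (simp_all add: vec_eq_iff forall_4 wrap affine_chart_def y_def)
  then show thesis ..
qed

lemma ordinary_double_point_pencil:
  assumes "P \<in> sing_points (pencil (Finite l))"
  shows "ordinary_double_point (pencil (Finite l)) P"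
proof -
  obtain x k where P: "P = proj_point x" and x: "x \<in> signed_vecs k" and lk: "l * of_nat k = -1"
    using assms by (auto simp: pencil_Finite sing_points_pencil_poly simp del: pencil.simps)
  have "k \<noteq> 0"
    using lk by (cases "k = 0") auto
  with x obtain i where "x $ i \<noteq> 0"
    by (rule signed_vecs_nonzero)
  then have c: "x $ i \<in> {1, -1}"
    using x by (auto simp: signed_vecs_def)
  \<comment> \<open>The entry \<open>x $ i\<close> is \<plusminus>1, hence its own inverse: this
    scaling puts a 1 at position \<open>i\<close> and keeps a sign vector.\<close>
  define z where "z = x $ i *s x"
  have "z $ i = 1"
    using c by (auto simp: z_def)
  then obtain y where y: "z = affine_chart i y"
    by (rule affine_chart_surj)
  have z: "z \<in> signed_vecs k"
    using x c by (auto simp: signed_vecs_def z_def)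
  have "(\<Sum>j\<in>UNIV. (z $ j)^2) = 1 + (\<Sum>j\<in>UNIV. (y $ j)^2)"
    unfolding y by (simp add: sum_affine_chart[where f = "\<lambda>z. z ^ 2"])
  then have "l * (1 + (\<Sum>j\<in>UNIV. (y $ j)^2)) = -1"
    using lk sum_squares_signed_vecs[OF z] by simp
  moreover have "y $ j \<in> {0, 1, -1}" for j
  proof -
    have "z $ (i + 1) \<in> {0, 1, -1}" "z $ (i + 2) \<in> {0, 1, -1}" "z $ (i + 3) \<in> {0, 1, -1}"
      using z by (auto simp: signed_vecs_def)
    then have "y $ 0 \<in> {0, 1, -1}" "y $ 1 \<in> {0, 1, -1}" "y $ 2 \<in> {0, 1, -1}"
      unfolding y affine_chart_def by simp_all
    moreover have "j = 0 \<or> j = 1 \<or> j = 2"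
      using exhaust_3[of j] by auto
    ultimately show ?thesis by blast
  qed
  ultimately have "affine_node (pencil_poly 1 l) y"
    by (intro affine_node_pencil_poly)
  moreover have "P = proj_point (affine_chart i y)"
    unfolding y[symmetric] z_def P using c by (subst proj_point_scale) auto
  ultimately show ?thesis
    unfolding ordinary_double_point_def pencil_affine_chart by blast
qed

section \<open>Counting the singular points\<close>

text \<open>A sign vector amounts to its support \<open>A\<close>, of size \<open>k\<close>, and the
  subset \<open>B\<close> of positions carrying -1.\<close>

lemma card_signed_vecs:
  "card (signed_vecs k :: (complex ^ 'n) set) = (CARD('n) choose k) * 2 ^ k"
proof -
  let ?S = "{A :: 'n set. A \<subseteq> UNIV \<and> card A = k}"
  let ?v = "\<lambda>(A, B). (\<chi> i. if i \<in> B then - 1 else if i \<in> A then 1 else 0) :: complex ^ 'n"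
  have "bij_betw ?v (Sigma ?S Pow) (signed_vecs k)"
  proof (rule bij_betw_byWitness[where f' = "\<lambda>x. ({i. x $ i \<noteq> 0}, {i. x $ i = - 1})"])
    \<comment> \<open>The left side is the union of \<open>A\<close> and \<open>B\<close>, the
      support of \<open>?v (A, B)\<close>.\<close>
    have "{i. i \<notin> A \<longrightarrow> i \<in> B} = A" if "B \<subseteq> A" for A B :: "'n set"
      using that by blast
    then show "\<forall>p\<in>Sigma ?S Pow. ({i. ?v p $ i \<noteq> 0}, {i. ?v p $ i = - 1}) = p"
      "?v ` Sigma ?S Pow \<subseteq> signed_vecs k"
      by (auto simp: signed_vecs_def split: if_splits)
    show "\<forall>x\<in>signed_vecs k. ?v ({i. x $ i \<noteq> 0}, {i. x $ i = - 1}) = x"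
      by (auto simp: signed_vecs_def vec_eq_iff)
    show "(\<lambda>x. ({i. x $ i \<noteq> 0}, {i. x $ i = - 1})) ` signed_vecs k \<subseteq> Sigma ?S Pow"
      by (auto simp: signed_vecs_def)
  qed
  then have "card (signed_vecs k :: (complex ^ 'n) set) = card (Sigma ?S Pow)"
    by (simp add: bij_betw_same_card)
  also have "\<dots> = (\<Sum>A\<in>?S. card (Pow A))"
    by (rule card_SigmaI) auto
  also have "\<dots> = (\<Sum>A\<in>?S. 2 ^ k)"
    by (rule sum.cong) (auto simp: card_Pow)
  also have "\<dots> = card ?S * 2 ^ k"
    by simp
  also have "card ?S = CARD('n) choose k"
    by (rule n_subsets) simp
  finally show ?thesis .
qed

text \<open>A nonzero scalar taking an entry \<plusminus>1 into {0, 1, -1} is itself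
  \<plusminus>1.\<close>

lemma proj_point_eq_signed_vecs:
  assumes x: "x \<in> signed_vecs k" and y: "y \<in> signed_vecs m" and k: "k \<noteq> 0"
  shows "proj_point x = proj_point y \<longleftrightarrow> y = x \<or> y = - x"
proof
  assume "proj_point x = proj_point y"
  then obtain c where c: "c \<noteq> 0" "y = c *s x"
    by (blast dest: proj_point_eqD)
  obtain i where i: "x $ i \<noteq> 0"
    using x k by (rule signed_vecs_nonzero)
  have "x $ i \<in> {1, -1}" "c * x $ i \<in> {0, 1, -1}"
    using x y i c by (auto simp: signed_vecs_def)
  with c have "c = 1 \<or> c = -1"
    by (auto simp: minus_equation_iff)
  with c show "y = x \<or> y = - x"
    by (auto simp: vec_eq_iff)
next
  have "- x = (-1) *s x"
    by (simp add: vec_eq_iff)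
  then have "proj_point (- x) = proj_point x"
    using proj_point_scale[of "-1" x] by simp
  then show "proj_point x = proj_point y" if "y = x \<or> y = - x"
    using that by auto
qed

text \<open>Each fibre of \<open>proj_point\<close> on sign vectors is a pair \<open>x\<close>,
  \<open>- x\<close>; the factor 2 on the left avoids a division.\<close>

lemma card_proj_signed_vecs:
  assumes "k \<noteq> 0"
  shows "2 * card (proj_point ` (signed_vecs k :: (complex ^ 'n) set)) = (CARD('n) choose k) * 2 ^ k"
proof (cases "k \<le> CARD('n)")
  case False
  then have "(signed_vecs k :: (complex ^ 'n) set) = {}"
    by (auto simp: signed_vecs_def card_mono)
  with False show ?thesis by simp
next
  case True
  let ?V = "signed_vecs k :: (complex ^ 'n) set"
  \<comment> \<open>Infinite sets have \<open>card\<close> 0, so a positive count yields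
    finiteness.\<close>
  have "card ?V > 0"
    using True by (simp add: card_signed_vecs)
  then have fin: "finite ?V"
    by (rule card_ge_0_finite)
  have fibre: "card {y \<in> ?V. proj_point y = proj_point x} = 2" if x: "x \<in> ?V" for x
  proof -
    have "- x \<in> ?V"
      using x by (auto simp: signed_vecs_def minus_equation_iff)
    then have "{y \<in> ?V. proj_point y = proj_point x} = {x, - x}"
      using x proj_point_eq_signed_vecs[OF x _ assms] by blast
    moreover have "x \<noteq> - x"
      using signed_vecs_nonzero[OF x assms] by (auto simp: vec_eq_iff)
    ultimately show ?thesis by simp
  qed
  have "card ?V = (\<Sum>P\<in>proj_point ` ?V. card {y \<in> ?V. proj_point y = P})"
    using sum.image_gen[OF fin, of "\<lambda>_. 1 :: nat" proj_point] by simp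
  also have "\<dots> = (\<Sum>P\<in>proj_point ` ?V. 2)"
    by (rule sum.cong) (use fibre in auto)
  finally show ?thesis
    by (simp add: card_signed_vecs)
qed

section \<open>Coordinate permutations and the explicit lists of points\<close>

text \<open>Complements of \<open>A\<close> and \<open>B\<close> also have equal size, so two
  bijections can be glued.\<close>

lemma bij_image_eq_if_card_eq:
  fixes A B :: "'n::finite set"
  assumes "card A = card B"
  obtains \<pi> where "bij \<pi>" "\<pi> ` A = B"
proof -
  have "card (- A) = card (- B)"
    using assms by (simp add: Compl_eq_Diff_UNIV card_Diff_subset)
  then obtain f g where f: "bij_betw f A B" and g: "bij_betw g (- A) (- B)"
    using assms by (meson finite finite_same_card_bij)
  have "bij_betw (\<lambda>i. if i \<in> A then f i else g i) (A \<union> - A) (B \<union> - B)"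
    using f g by (intro bij_betw_disjoint_Un) auto
  then have "bij (\<lambda>i. if i \<in> A then f i else g i)"
    by simp
  moreover have "(\<lambda>i. if i \<in> A then f i else g i) ` A = B"
    using f by (auto simp: bij_betw_def)
  ultimately show thesis
    by (rule that)
qed

text \<open>Permutations carry the support \<open>B\<close> onto every set of the same size, so only
  \<open>card B\<close> matters.\<close>

lemma perm_points_signed:
  fixes B :: "4 set"
  shows "perm_points {v. \<forall>i. if i \<in> B then v $ i \<in> pm1 else v $ i = 0} =
           proj_point ` signed_vecs (card B)"
    (is "perm_points ?V = _")
proof (intro equalityI subsetI)
  fix P assume "P \<in> perm_points ?V"
  then obtain v \<pi> where P: "P = proj_point (\<chi> i. v $ \<pi> i)" and v: "v \<in> ?V" and "bij \<pi>"
    unfolding perm_points_def by blast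
  have "v $ i \<noteq> 0 \<longleftrightarrow> i \<in> B" for i
    using v by (auto split: if_splits) (metis one_neq_zero zero_neq_neg_one)
  then have "{i. v $ \<pi> i \<noteq> 0} = \<pi> -` B"
    by auto
  then have "card {i. v $ \<pi> i \<noteq> 0} = card B"
    using \<open>bij \<pi>\<close> by (simp add: card_vimage_inj bij_is_inj bij_is_surj)
  moreover have "v $ \<pi> i \<in> {0, 1, -1}" for i
    using v by (auto split: if_splits)
  ultimately have "(\<chi> i. v $ \<pi> i) \<in> signed_vecs (card B)"
    by (simp add: signed_vecs_def)
  then show "P \<in> proj_point ` signed_vecs (card B)"
    using P by blast
next
  fix P :: "(complex ^ 4) set" assume "P \<in> proj_point ` signed_vecs (card B)"
  then obtain x where P: "P = proj_point x" and x: "x \<in> signed_vecs (card B)"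
    by blast
  then have "card {i. x $ i \<noteq> 0} = card B"
    by (simp add: signed_vecs_def)
  then obtain \<pi> where pi: "bij \<pi>" "\<pi> ` {i. x $ i \<noteq> 0} = B"
    by (rule bij_image_eq_if_card_eq)
  \<comment> \<open>The inverse permutation moves the support of \<open>x\<close> onto
    \<open>B\<close>, and reading \<open>v\<close> along \<open>\<pi>\<close> gives back
    \<open>x\<close>.\<close>
  define v where "v = (\<chi> i. x $ inv \<pi> i)"
  have "i \<in> B \<longleftrightarrow> x $ inv \<pi> i \<noteq> 0" for i
  proof -
    have "\<pi> (inv \<pi> i) \<in> \<pi> ` {i. x $ i \<noteq> 0} \<longleftrightarrow> x $ inv \<pi> i \<noteq> 0"
      using bij_is_inj[OF pi(1)] by (simp only: inj_image_mem_iff mem_Collect_eq)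
    then show ?thesis
      using pi by (simp add: surj_f_inv_f bij_is_surj)
  qed
  then have "v \<in> ?V"
    using x by (auto simp: v_def signed_vecs_def)
  moreover have "x = (\<chi> i. v $ \<pi> i)"
    using pi by (simp add: v_def vec_eq_iff bij_is_inj)
  ultimately show "P \<in> perm_points ?V"
    unfolding perm_points_def P using pi by blast
qed

lemma forall_UNIV_4: "(\<forall>i :: 4. P i) \<longleftrightarrow> P 0 \<and> P 1 \<and> P 2 \<and> P 3"
proof -
  have four: "(4 :: 4) = 0" by simp
  show ?thesis unfolding forall_4 four by auto
qed

lemma eq_coords_iff: "v = coords a b c d \<longleftrightarrow> v $ 0 = a \<and> v $ 1 = b \<and> v $ 2 = c \<and> v $ 3 = d"
  by (simp add: vec_eq_iff forall_UNIV_4 coords_def)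

text \<open>Here the list has no signs: the vector with entry -1 gives the same projective
  points.\<close>

lemma perm_points_coords_1:
  "perm_points {coords 1 0 0 0} = proj_point ` signed_vecs 1"
proof -
  have V: "{v. \<forall>i. if i \<in> {0 :: 4} then v $ i \<in> pm1 else v $ i = 0} =
      {coords 1 0 0 0, coords (-1) 0 0 0}"
    by (auto simp: forall_UNIV_4 eq_coords_iff) (auto simp: coords_def)
  have "proj_point (\<chi> i. coords (-1) 0 0 0 $ \<pi> i) = proj_point (\<chi> i. coords 1 0 0 0 $ \<pi> i)" for \<pi>
  proof -
    have "(\<chi> i. coords (-1) 0 0 0 $ \<pi> i) = (-1) *s (\<chi> i. coords 1 0 0 0 $ \<pi> i)"
      by (simp add: vec_eq_iff coords_def)
    then show ?thesis by (metis proj_point_scale neg_equal_0_iff_equal one_neq_zero)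
  qed
  then have "perm_points {coords 1 0 0 0} = perm_points {coords 1 0 0 0, coords (-1) 0 0 0}"
    unfolding perm_points_def by blast
  also have "\<dots> = proj_point ` signed_vecs 1"
    unfolding V[symmetric] perm_points_signed by simp
  finally show ?thesis .
qed

lemma perm_points_coords_2:
  "perm_points {coords a b 0 0 | a b. a \<in> pm1 \<and> b \<in> pm1} = proj_point ` signed_vecs 2"
proof -
  have "{coords a b 0 0 | a b. a \<in> pm1 \<and> b \<in> pm1} =
      {v. \<forall>i. if i \<in> {0, 1} then v $ i \<in> pm1 else v $ i = 0}"
    by (auto simp: forall_UNIV_4 eq_coords_iff)
  then show ?thesis
    by (simp only: perm_points_signed) (simp add: numeral_2_eq_2)
qed

lemma perm_points_coords_3:
  "perm_points {coords a b c 0 | a b c. a \<in> pm1 \<and> b \<in> pm1 \<and> c \<in> pm1} =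
     proj_point ` signed_vecs 3"
proof -
  have "{coords a b c 0 | a b c. a \<in> pm1 \<and> b \<in> pm1 \<and> c \<in> pm1} =
      {v. \<forall>i. if i \<in> {0, 1, 2} then v $ i \<in> pm1 else v $ i = 0}"
    by (auto simp: forall_UNIV_4 eq_coords_iff)
  then show ?thesis
    by (simp only: perm_points_signed) (simp add: numeral_3_eq_3)
qed

text \<open>With full support every permutation preserves the set of sign vectors, so the list is
  already complete without \<open>perm_points\<close>.\<close>

lemma proj_points_coords_4:
  "{proj_point (coords a b c d) | a b c d. a \<in> pm1 \<and> b \<in> pm1 \<and> c \<in> pm1 \<and> d \<in> pm1} =
     proj_point ` signed_vecs 4"
proof -
  have "x \<in> signed_vecs 4 \<longleftrightarrow> (\<forall>i. x $ i \<in> pm1)" for x :: "complex ^ 4"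
  proof -
    have "card {i. x $ i \<noteq> 0} = 4 \<longleftrightarrow> {i. x $ i \<noteq> 0} = UNIV"
      using card_subset_eq[of UNIV "{i. x $ i \<noteq> 0}"] by auto
    then have "x \<in> signed_vecs 4 \<longleftrightarrow> (\<forall>i. x $ i \<in> {0, 1, -1}) \<and> (\<forall>i. x $ i \<noteq> 0)"
      unfolding signed_vecs_def by blast
    moreover have "z \<in> {0, 1, -1} \<and> z \<noteq> 0 \<longleftrightarrow> z \<in> pm1" for z :: complex
      by auto
    ultimately show ?thesis
      by metis
  qed
  then have "signed_vecs 4 = {coords a b c d | a b c d. a \<in> pm1 \<and> b \<in> pm1 \<and> c \<in> pm1 \<and> d \<in> pm1}"
    by (auto simp: forall_UNIV_4 eq_coords_iff)
  then show ?thesis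
    by (simp only:) blast
qed

section \<open>The singular members and the final assembly\<close>

text \<open>Sign vectors with \<open>k\<close> nonzero entries exist exactly for
  \<open>k \<le> 4\<close>, and \<open>k = 0\<close> would give 0 = -1.\<close>

lemma singular_surface_pencil_iff:
  "singular_surface (pencil (Finite l)) \<longleftrightarrow> l \<in> {-1, -(1/2), -(1/3), -(1/4)}"
proof -
  have ne: "(signed_vecs k :: (complex ^ 4) set) \<noteq> {} \<longleftrightarrow> k \<le> 4" for k
  proof
    assume "(signed_vecs k :: (complex ^ 4) set) \<noteq> {}"
    then obtain x :: "complex ^ 4" where "card {i. x $ i \<noteq> 0} = k"
      by (auto simp: signed_vecs_def)
    moreover have "card {i. x $ i \<noteq> 0} \<le> CARD(4)"
      by (rule card_mono) auto
    ultimately show "k \<le> 4" by simp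
  next
    assume "k \<le> 4"
    then have "card (signed_vecs k :: (complex ^ 4) set) \<noteq> 0"
      by (simp add: card_signed_vecs)
    then show "(signed_vecs k :: (complex ^ 4) set) \<noteq> {}" by auto
  qed
  have "singular_surface (pencil (Finite l)) \<longleftrightarrow> (\<exists>k\<le>4. l * of_nat k = -1)"
    unfolding singular_surface_def pencil_Finite sing_points_pencil_poly using ne by blast
  also have "\<dots> \<longleftrightarrow> (\<exists>k\<in>{0, 1, 2, 3, 4}. l * of_nat k = -1)"
  proof -
    have "{..4} = {0, 1, 2, 3, 4 :: nat}" by auto
    then show ?thesis by (metis atMost_iff)
  qed
  also have "\<dots> \<longleftrightarrow> l \<in> {-1, -(1/2), -(1/3), -(1/4)}"
    by (auto simp: field_simps eq_neg_iff_add_eq_0)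
  finally show ?thesis .
qed

theorem mainTheorem4:
  shows "({l. l \<noteq> Infinity \<and> singular_surface (pencil l)} =
           Finite ` {-1, -(1/2), -(1/3), -(1/4)})
    \<and> (\<forall>l. l \<noteq> Infinity \<longrightarrow>
           (\<forall>P \<in> sing_points (pencil l). ordinary_double_point (pencil l) P))
    \<and> (sing_points (pencil (Finite (-1))) = perm_points {coords 1 0 0 0})
    \<and> (card (sing_points (pencil (Finite (-1)))) = 4)
    \<and> (sing_points (pencil (Finite (-(1/2)))) =
           perm_points {coords a b 0 0 | a b. a \<in> pm1 \<and> b \<in> pm1})
    \<and> (card (sing_points (pencil (Finite (-(1/2))))) = 12)
    \<and> (sing_points (pencil (Finite (-(1/3)))) =
           perm_points {coords a b c 0 | a b c. a \<in> pm1 \<and> b \<in> pm1 \<and> c \<in> pm1})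
    \<and> (card (sing_points (pencil (Finite (-(1/3))))) = 16)
    \<and> (sing_points (pencil (Finite (-(1/4)))) =
           {proj_point (coords a b c d) | a b c d.
              a \<in> pm1 \<and> b \<in> pm1 \<and> c \<in> pm1 \<and> d \<in> pm1})
    \<and> (card (sing_points (pencil (Finite (-(1/4))))) = 8)"
proof -
  have sing: "sing_points (pencil (Finite (-1))) = proj_point ` signed_vecs 1"
    "sing_points (pencil (Finite (-(1/2)))) = proj_point ` signed_vecs 2"
    "sing_points (pencil (Finite (-(1/3)))) = proj_point ` signed_vecs 3"
    "sing_points (pencil (Finite (-(1/4)))) = proj_point ` signed_vecs 4"
    using sing_points_pencil[of 1] sing_points_pencil[of 2] sing_points_pencil[of 3]
      sing_points_pencil[of 4] by simp_all
  \<comment> \<open>These are the values of \<open>(4 choose k) * 2 ^ k / 2\<close> for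
    \<open>k\<close> from 1 to 4.\<close>
  have card: "card (proj_point ` (signed_vecs 1 :: (complex ^ 4) set)) = 4"
    "card (proj_point ` (signed_vecs 2 :: (complex ^ 4) set)) = 12"
    "card (proj_point ` (signed_vecs 3 :: (complex ^ 4) set)) = 16"
    "card (proj_point ` (signed_vecs 4 :: (complex ^ 4) set)) = 8"
    using card_proj_signed_vecs[of 1, where 'n = 4] card_proj_signed_vecs[of 2, where 'n = 4]
      card_proj_signed_vecs[of 3, where 'n = 4] card_proj_signed_vecs[of 4, where 'n = 4]
    by (simp_all add: eval_nat_numeral)
  have "{l. l \<noteq> Infinity \<and> singular_surface (pencil l)} = Finite ` {-1, -(1/2), -(1/3), -(1/4)}"
  proof (rule set_eqI)
    fix l
    show "l \<in> {l. l \<noteq> Infinity \<and> singular_surface (pencil l)} \<longleftrightarrow>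
        l \<in> Finite ` {-1, -(1/2), -(1/3), -(1/4)}"
      by (cases l) (auto simp: singular_surface_pencil_iff simp del: pencil.simps)
  qed
  moreover have "ordinary_double_point (pencil l) P"
    if "l \<noteq> Infinity" "P \<in> sing_points (pencil l)" for l P
    using that by (cases l) (auto intro: ordinary_double_point_pencil simp del: pencil.simps)
  ultimately show ?thesis
    unfolding sing perm_points_coords_1 perm_points_coords_2 perm_points_coords_3
      proj_points_coords_4
    using card by blast
qed

end
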